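(* Let $\mathcal H$ be a separable Hilbert space, let $a,b,c\ge 0$, and let $\mathcal W_w=\{(\mathcal W_i,w_i)\}_{i\in I}$ and $\mathcal V_v=\{(\mathcal V_i,v_i)\}_{i\in I}$ be two weighted collections of closed subspaces of $\mathcal H$ such that for all $f\in\mathcal H$, $$\Big(\sum_{i\in I}\|(w_iP_{\mathcal W_i}-v_iP_{\mathcal V_i})f\|^2\Big)^{1/2}\le a\Big(\sum_{i\in I}w_i^2\|P_{\mathcal W_i}f\|^2\Big)^{1/2}+b\Big(\sum_{i\in I}v_i^2\|P_{\mathcal V_i}f\|^2\Big)^{1/2}+c\,\Lambda(f),$$ for some function $\Lambda:\mathcal H\to\mathbb R_+=[0,\infty)$. Then the following hold. (1) Let $\mathcal W_w$ be a fusion Bessel sequence in $\mathcal H$, $b<1$ and $c=0$. Then $\mathcal V_v$ is a $K$-fusion frame for $\mathcal H$ for every $K\in\mathcal L(\mathcal H)$ satisfying $R(K)\subseteq R(T_{\mathcal V})$, where $T_{\mathcal V}$ is the synthesis operator associated with $\mathcal V_v$. (2) Let $K\in\mathcal L(\mathcal H)$, let $\mathcal W_w$ be a $K$-fusion frame for $\mathcal H$ with bounds $A,B>0$, and let $\Lambda(f)=\|K^*f\|$. If $a<1$, $b<1$ and $0\le\frac{c}{1-a}<\sqrt A$, then $\mathcal V_v$ is also a $K$-fusion frame for $\mathcal H$, with bounds $\left(\frac{\sqrt A(1-a)-c}{1+b}\right)^2$ and $\left(\frac{(1+a)\sqrt B+c\|K\|}{1-b}\right)^2$. (3) Let $\mathcal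 W_w$ be a fusion frame for $\mathcal H$ with bounds $A,B>0$ and let $\Lambda(f)=\|f\|$. If $a\sqrt B+c<\sqrt A$ and $b<1$, then $\mathcal V_v$ is a fusion frame for $\mathcal H$ with bounds $\left(\frac{\sqrt A-c-a\sqrt B}{1+b}\right)^2$ and $\left(\frac{(1+a)\sqrt B+c}{1-b}\right)^2$.
   Context: $\mathcal L(\mathcal H)$ is the space of bounded linear operators on $\mathcal H$; $R(T)$ is the range of $T$. The index set $I$ is finite or countable. $P_{\mathcal W}$ is the orthogonal projection onto a closed subspace $\mathcal W$. A weighted collection of closed subspaces $\{(\mathcal W_i,w_i)\}_{i\in I}$ consists of closed subspaces $\mathcal W_i$ of $\mathcal H$ and real scalars $w_i$. The collection $\mathcal W_w$ is: a fusion Bessel sequence with bound $B>0$ if $\sum_{i\in I}w_i^2\|P_{\mathcal W_i}f\|^2\le B\|f\|^2$ for all $f\in\mathcal H$; a fusion frame with bounds $A,B>0$ if moreover $A\|f\|^2\le\sum_{i\in I}w_i^2\|P_{\mathcal W_i}f\|^2$ for all $f\in\mathcal H$; for $K\in\mathcal L(\mathcal H)$, a $K$-fusion frame with bounds $A,B>0$ if $A\|K^*f\|^2\le\sum_{i\in I}w_i^2\|P_{\mathcal W_i}f\|^2\le B\|f\|^2$ for all $f\in\mathcal H$. The associated synthesis operator of $\mathcal V_v$ is $T_{\mathcal V}:\left(\sum_{i\in I}\bigoplus\mathcal V_i\right)_{l^2}\to\mathcal H$, $T_{\mathcal V}(\{f_i\}_{i\in I})=\sum_{i\in I}v_if_i$,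 where $\left(\sum_{i\in I}\bigoplus\mathcal V_i\right)_{l^2}=\{\{f_i\}_{i\in I}:f_i\in\mathcal V_i,\ \sum_{i\in I}\|f_i\|^2<\infty\}$ with inner product $\langle\{f_i\},\{g_i\}\rangle=\sum_{i\in I}\langle f_i,g_i\rangle$. It is a well-defined bounded operator whenever $\mathcal V_v$ is a fusion Bessel sequence. The displayed perturbation inequality is read as an inequality between finite real numbers, i.e. the series appearing in it converge. *)

theory Defs
  imports "HOL-Analysis.Analysis"
begin

text \<open>
  The scalar field is \<open>\<real>\<close> or \<open>\<complex>\<close>. The class below captures exactly these two normed fields
  (see \<open>rc_field_real_or_complex\<close>), with \<open>conjg\<close> forced to be the identity, respectively
  complex conjugation.
\<close>

class rc_field = real_normed_field +
  fixes conjg :: "'a \<Rightarrow> 'a"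
  assumes conjg_add: "conjg (x + y) = conjg x + conjg y"
    and mult_conjg_scaleR: "x * conjg x = (norm x)\<^sup>2 *\<^sub>R 1"

instantiation real :: rc_field
begin
definition conjg_real :: "real \<Rightarrow> real" where "conjg_real x = x"
instance
  by standard (simp_all add: conjg_real_def power2_eq_square)
end

instantiation complex :: rc_field
begin
definition conjg_complex :: "complex \<Rightarrow> complex" where "conjg_complex = cnj"
instance
proof
  fix x y :: complex
  show "conjg (x + y) = conjg x + conjg y"
    by (simp add: conjg_complex_def)
  show "x * conjg x = (norm x)\<^sup>2 *\<^sub>R 1"
    by (simp add: conjg_complex_def complex_norm_square[symmetric] scaleR_conv_of_real del: of_real_power)
qed
end

lemma mult_conjg: "x * conjg x = of_real ((norm x)\<^sup>2)" for x :: "'a::rc_field"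
  unfolding mult_conjg_scaleR of_real_def ..

lemma conjg_of_real [simp]: "conjg (of_real r :: 'a::rc_field) = of_real r"
proof (cases "r = 0")
  case True
  have "conjg (0::'a) + conjg 0 = conjg 0"
    using conjg_add[of "0::'a" 0] by simp
  then show ?thesis using True by simp
next
  case False
  have "of_real r * conjg (of_real r :: 'a) = of_real r * of_real r"
    by (simp add: mult_conjg power2_eq_square)
  then show ?thesis using False by simp
qed

lemma add_conjg_real: "x + conjg x \<in> \<real>" for x :: "'a::rc_field"
proof -
  have c1: "conjg (1::'a) = 1" using conjg_of_real[of 1] by simp
  have "(1 + x) * conjg (1 + x) - x * conjg x - 1 = x + conjg x"
    unfolding conjg_add c1 by (simp add: algebra_simps)
  moreover have "(1 + x) * conjg (1 + x) - x * conjg x - 1 \<in> \<real>"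
    unfolding mult_conjg by (intro Reals_diff Reals_of_real Reals_1)
  ultimately show ?thesis by simp
qed

lemma rc_field_real_or_complex:
  "(\<forall>x::'a::rc_field. x \<in> \<real>) \<or>
   (\<exists>j::'a. j * j = -1 \<and> (\<forall>x. \<exists>a b. x = of_real a + of_real b * j))"
proof (rule disjCI)
  assume "\<not> (\<exists>j::'a. j * j = -1 \<and> (\<forall>x. \<exists>a b. x = of_real a + of_real b * j))"
  show "\<forall>x::'a. x \<in> \<real>"
  proof (rule ccontr)
    assume "\<not> (\<forall>x::'a. x \<in> \<real>)"
    then obtain x0 :: 'a where x0: "x0 \<notin> \<real>" by blast
    have dec: "\<exists>r u. x = of_real r + u \<and> u * u = - of_real ((norm u)\<^sup>2)" for x :: 'a
    proof -
      obtain s where s: "x + conjg x = of_real s"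
        using add_conjg_real[of x] by (auto elim: Reals_cases)
      define u where "u = x - of_real (s / 2)"
      have "conjg x = conjg (of_real (s / 2)) + conjg u"
        unfolding conjg_add[symmetric] by (simp add: u_def)
      then have "conjg u = conjg x - of_real (s / 2)"
        unfolding conjg_of_real by (simp only: add_diff_cancel_left')
      also have "conjg x = of_real s - x" using s by (simp add: algebra_simps)
      finally have "conjg u = - u" by (simp add: u_def)
      then have "u * u = - of_real ((norm u)\<^sup>2)"
        using mult_conjg[of u] by (simp add: minus_equation_iff[of "u * u"])
      then show ?thesis by (intro exI[of _ "s / 2"] exI[of _ u]) (simp add: u_def)
    qed
    obtain r u where u: "x0 = of_real r + u" "u * u = - of_real ((norm u)\<^sup>2)"
      using dec by blast
    have nz: "u \<noteq> 0" using x0 u(1) by auto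
    define j where "j = u / of_real (norm u)"
    have jj: "j * j = -1"
      using u(2) nz by (simp add: j_def power2_eq_square)
    have "\<exists>a b. x = of_real a + of_real b * j" for x :: 'a
    proof -
      obtain a w where w: "x = of_real a + w" "w * w = - of_real ((norm w)\<^sup>2)"
        using dec by blast
      have "(w - of_real (norm w) * j) * (w + of_real (norm w) * j) = 0"
      proof -
        let ?n = "of_real (norm w) :: 'a"
        have "(w - ?n * j) * (w + ?n * j) = w * w - ?n * ?n * (j * j)"
          by (simp add: algebra_simps)
        then show ?thesis using w(2) jj by (simp add: power2_eq_square)
      qed
      then have "w = of_real (norm w) * j \<or> w = of_real (- norm w) * j"
        unfolding mult_eq_0_iff right_minus_eq by (auto simp: eq_neg_iff_add_eq_0)
      then show ?thesis using w(1) by metis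
    qed
    then show False
      using jj \<open>\<not> (\<exists>j::'a. j * j = -1 \<and> (\<forall>x. \<exists>a b. x = of_real a + of_real b * j))\<close> by blast
  qed
qed

text \<open>
  A Hilbert space over \<open>'k\<close> with scalar multiplication \<open>scl\<close> and inner product \<open>ip\<close>. Its
  norm, metric and completeness are those of the type \<open>'h\<close>; the inner product of the type
  class is then the real part of \<open>ip\<close> (see \<open>ip_real_part\<close>), so every real or complex Hilbert
  space is of this form.
\<close>

locale hilbert_over = vector_space scl
  for scl :: "'k::rc_field \<Rightarrow> 'h::{real_inner, complete_space} \<Rightarrow> 'h" +
  fixes ip :: "'h \<Rightarrow> 'h \<Rightarrow> 'k"
  assumes scl_of_real: "scl (of_real r) x = r *\<^sub>R x"
    and ip_add: "ip (x + y) z = ip x z + ip y z"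
    and ip_scl: "ip (scl c x) y = c * ip x y"
    and ip_conjg: "ip y x = conjg (ip x y)"
    and ip_norm: "ip x x = of_real ((norm x)\<^sup>2)"
begin

lemma ip_real_part: "ip x y + conjg (ip x y) = of_real (2 * inner x y)"
proof -
  have right: "ip x (y + z) = ip x y + ip x z" for x y z
    by (metis ip_conjg ip_add conjg_add)
  have "ip (x + y) (x + y) = ip x x + ip x y + ip y x + ip y y"
    by (simp add: ip_add right)
  then have "ip x y + ip y x = of_real ((norm (x + y))\<^sup>2 - (norm x)\<^sup>2 - (norm y)\<^sup>2)"
    by (simp add: ip_norm)
  also have "(norm (x + y))\<^sup>2 - (norm x)\<^sup>2 - (norm y)\<^sup>2 = 2 * inner x y"
    by (simp add: power2_norm_eq_inner inner_add inner_commute)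
  finally show ?thesis using ip_conjg[of y x] by simp
qed

end

lemma hilbert_over_real:
  "hilbert_over (scaleR :: real \<Rightarrow> 'h::{real_inner, complete_space} \<Rightarrow> 'h) inner"
  by unfold_locales
    (simp_all add: algebra_simps inner_add inner_commute conjg_real_def power2_norm_eq_inner)

lemma hilbert_over_complex: "hilbert_over ((*) :: complex \<Rightarrow> _) (\<lambda>x y. x * cnj y)"
  by unfold_locales
    (simp_all add: algebra_simps scaleR_conv_of_real conjg_complex_def
      complex_norm_square[symmetric] del: of_real_power)

definition closed_subspace :: "('k::rc_field \<Rightarrow> 'h::real_inner \<Rightarrow> 'h) \<Rightarrow> 'h set \<Rightarrow> bool" where
  "closed_subspace scl W \<longleftrightarrow> module.subspace scl W \<and> closed W"

definition bounded_op :: "('k::rc_field \<Rightarrow> 'h::real_inner \<Rightarrow> 'h) \<Rightarrow> ('h \<Rightarrow> 'h) \<Rightarrow> bool" where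
  "bounded_op scl K \<longleftrightarrow> Vector_Spaces.linear scl scl K \<and> bounded_linear K"

definition adj :: "('h \<Rightarrow> 'h \<Rightarrow> 'k) \<Rightarrow> ('h \<Rightarrow> 'h) \<Rightarrow> 'h \<Rightarrow> 'h" where
  "adj ip K = (THE L. \<forall>x y. ip (K x) y = ip x (L y))"

definition orth_proj :: "('h::real_inner \<Rightarrow> 'h \<Rightarrow> 'k::rc_field) \<Rightarrow> 'h set \<Rightarrow> 'h \<Rightarrow> 'h" where
  "orth_proj ip W f = (THE g. g \<in> W \<and> (\<forall>h\<in>W. ip (f - g) h = 0))"

definition weighted_collection ::
    "('k::rc_field \<Rightarrow> 'h::real_inner \<Rightarrow> 'h) \<Rightarrow> 'i set \<Rightarrow> ('i \<Rightarrow> 'h set) \<Rightarrow> ('i \<Rightarrow> real) \<Rightarrow> bool" where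
  "weighted_collection scl I W w \<longleftrightarrow> (\<forall>i\<in>I. closed_subspace scl (W i))"

definition fusion_term ::
    "('h::real_inner \<Rightarrow> 'h \<Rightarrow> 'k::rc_field) \<Rightarrow> ('i \<Rightarrow> 'h set) \<Rightarrow> ('i \<Rightarrow> real) \<Rightarrow> 'h \<Rightarrow> 'i \<Rightarrow> real" where
  "fusion_term ip W w f i = (w i)\<^sup>2 * (norm (orth_proj ip (W i) f))\<^sup>2"

text \<open>
  \<open>infsum\<close> is \<open>0\<close> for families that are not summable, so summability is required explicitly
  wherever a bound on a sum is stated.
\<close>

definition fusion_bessel ::
    "('h::real_inner \<Rightarrow> 'h \<Rightarrow> 'k::rc_field) \<Rightarrow> 'i set \<Rightarrow> ('i \<Rightarrow> 'h set) \<Rightarrow> ('i \<Rightarrow> real) \<Rightarrow> real \<Rightarrow> bool" where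
  "fusion_bessel ip I W w B \<longleftrightarrow> B > 0 \<and>
     (\<forall>f. fusion_term ip W w f summable_on I \<and>
          (\<Sum>\<^sub>\<infinity>i\<in>I. fusion_term ip W w f i) \<le> B * (norm f)\<^sup>2)"

definition fusion_frame ::
    "('h::real_inner \<Rightarrow> 'h \<Rightarrow> 'k::rc_field) \<Rightarrow> 'i set \<Rightarrow> ('i \<Rightarrow> 'h set) \<Rightarrow> ('i \<Rightarrow> real) \<Rightarrow> real \<Rightarrow> real \<Rightarrow> bool"
  where
  "fusion_frame ip I W w A B \<longleftrightarrow> fusion_bessel ip I W w B \<and> A > 0 \<and>
     (\<forall>f. A * (norm f)\<^sup>2 \<le> (\<Sum>\<^sub>\<infinity>i\<in>I. fusion_term ip W w f i))"

definition K_fusion_frame ::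
    "('h::real_inner \<Rightarrow> 'h \<Rightarrow> 'k::rc_field) \<Rightarrow> ('h \<Rightarrow> 'h) \<Rightarrow> 'i set \<Rightarrow> ('i \<Rightarrow> 'h set) \<Rightarrow> ('i \<Rightarrow> real)
      \<Rightarrow> real \<Rightarrow> real \<Rightarrow> bool" where
  "K_fusion_frame ip K I W w A B \<longleftrightarrow> A > 0 \<and> B > 0 \<and>
     (\<forall>f. fusion_term ip W w f summable_on I \<and>
          A * (norm (adj ip K f))\<^sup>2 \<le> (\<Sum>\<^sub>\<infinity>i\<in>I. fusion_term ip W w f i) \<and>
          (\<Sum>\<^sub>\<infinity>i\<in>I. fusion_term ip W w f i) \<le> B * (norm f)\<^sup>2)"

definition l2_direct_sum :: "'i set \<Rightarrow> ('i \<Rightarrow> 'h::real_inner set) \<Rightarrow> ('i \<Rightarrow> 'h) set" where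
  "l2_direct_sum I V = {f \<in> Pi\<^sub>E I V. (\<lambda>i. (norm (f i))\<^sup>2) summable_on I}"

definition synthesis :: "'i set \<Rightarrow> ('i \<Rightarrow> real) \<Rightarrow> ('i \<Rightarrow> 'h::real_inner) \<Rightarrow> 'h" where
  "synthesis I v f = (\<Sum>\<^sub>\<infinity>i\<in>I. v i *\<^sub>R f i)"

end

theory Submission
  imports Defs
begin

text \<open>
  Write \<open>D(f)\<close>, \<open>S_W(f)\<close> and \<open>S_V(f)\<close> for the \<open>l\<^sup>2\<close> norms of the families
  \<open>(w_i P_{W_i} - v_i P_{V_i}) f\<close>, \<open>w_i P_{W_i} f\<close> and \<open>v_i P_{V_i} f\<close>. The hypothesis says
  \<open>D \<le> a S_W + b S_V + c \<Lambda>\<close>, and Minkowski's inequality says that \<open>S_W\<close> and \<open>S_V\<close> differ by at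
  most \<open>D\<close>. Together (\<open>perturbation_two_sided\<close>),
  \<open>(1 - b) S_V \<le> (1 + a) S_W + c \<Lambda>\<close> and \<open>(1 - a) S_W - c \<Lambda> \<le> (1 + b) S_V\<close>.
  Inserting the frame bounds of the first collection, and \<open>\<parallel>K\<^sup>* f\<parallel> \<le> \<parallel>K\<parallel> \<parallel>f\<parallel>\<close> where
  \<open>\<Lambda>(f) = \<parallel>K\<^sup>* f\<parallel>\<close>, gives the second and third parts, and the Bessel bound in the first.

  The lower bound in the first part is one half of Douglas' range inclusion theorem. The usual
  proof applies the closed graph theorem to a factorisation \<open>K = T_V X\<close>. The uniform boundedness
  principle gives it more directly: if \<open>K x = T_V y\<close>, then
  \<open>\<bar>\<langle>K\<^sup>* f, x\<rangle>\<bar> = \<bar>\<langle>f, T_V y\<rangle>\<bar> \<le> \<parallel>y\<parallel> S_V(f)\<close> by the Cauchy-Schwarz inequality in \<open>l\<^sup>2\<close>, with a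
  constant \<open>\<parallel>y\<parallel>\<close> that depends on \<open>x\<close> alone. So the vectors \<open>K\<^sup>* f / S_V(f)\<close> are weakly bounded,
  hence bounded in norm (\<open>weakly_dominated_imp_dominated\<close>).

  Orthogonal projections and adjoints are given by definite descriptions, so what remains is to show
  that they exist: nearest points by the parallelogram law, then the decomposition along a
  closed subspace, the Riesz representation and the adjoint. This is done for the real inner product
  first; linearity over the scalars then carries orthogonality and the adjoint identity over to the
  scalar-valued product, since a scalar \<open>d\<close> vanishes once the real part of each of its multiples does.
\<close>

section \<open>Projections and functionals on a real Hilbert space\<close>

text \<open>
  A minimizing sequence is Cauchy: midpoints stay in the convex set, so by the parallelogram law two
  points whose squared distances to \<open>x\<close> are nearly minimal are close to each other.
\<close>

lemma nearest_point_exists: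
  fixes S :: "'h::{real_inner, complete_space} set"
  assumes "convex S" "closed S" "S \<noteq> {}"
  shows "\<exists>g\<in>S. \<forall>h\<in>S. dist x g \<le> dist x h"
proof -
  define d where "d = infdist x S"
  have d0: "0 \<le> d" by (simp add: d_def infdist_nonneg)
  have le: "d \<le> dist x h" if "h \<in> S" for h
    using that by (simp add: d_def infdist_le)
  have "\<exists>h\<in>S. (dist x h)\<^sup>2 < d\<^sup>2 + inverse (real (Suc n))" for n
  proof -
    have "(INF h\<in>S. dist x h) < sqrt (d\<^sup>2 + inverse (real (Suc n)))"
      using assms(3) d0 by (intro real_less_rsqrt) (simp add: d_def infdist_notempty)
    then obtain h where "h \<in> S" "dist x h < sqrt (d\<^sup>2 + inverse (real (Suc n)))"
      using cInf_lessD[of "dist x ` S"] assms(3) by auto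
    moreover from this(2) have "(dist x h)\<^sup>2 < (sqrt (d\<^sup>2 + inverse (real (Suc n))))\<^sup>2"
      by (intro power_strict_mono) auto
    ultimately show ?thesis by auto
  qed
  then obtain s where s: "s n \<in> S" "(dist x (s n))\<^sup>2 < d\<^sup>2 + inverse (real (Suc n))" for n
    by metis
  have close: "(dist (s m) (s n))\<^sup>2 \<le> 2 * inverse (real (Suc m)) + 2 * inverse (real (Suc n))"
    for m n
  proof -
    let ?p = "(1/2) *\<^sub>R s m + (1/2) *\<^sub>R s n"
    have "?p \<in> S" using convexD[OF assms(1) s(1) s(1)] by auto
    then have "d\<^sup>2 \<le> (dist x ?p)\<^sup>2" using le d0 by (intro power_mono) auto
    moreover have "(dist (s m) (s n))\<^sup>2 = 2 * (dist x (s m))\<^sup>2 + 2 * (dist x (s n))\<^sup>2 - 4 * (dist x ?p)\<^sup>2"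
      unfolding dist_norm power2_norm_eq_inner
      by (simp add: inner_diff_left inner_diff_right inner_add_left inner_add_right inner_commute
          algebra_simps)
    ultimately show ?thesis using s(2)[of m] s(2)[of n] by linarith
  qed
  have "Cauchy s"
  proof (rule metric_CauchyI)
    fix e :: real assume "e > 0"
    then obtain N where N: "inverse (real (Suc N)) < e\<^sup>2 / 4"
      using reals_Archimedean[of "e\<^sup>2 / 4"] by auto
    have "dist (s m) (s n) < e" if "m \<ge> N" "n \<ge> N" for m n
    proof -
      have "inverse (real (Suc m)) \<le> inverse (real (Suc N))" "inverse (real (Suc n)) \<le> inverse (real (Suc N))"
        using that by (auto intro!: le_imp_inverse_le)
      then have "(dist (s m) (s n))\<^sup>2 < e\<^sup>2" using close[of m n] N by linarith
      then show ?thesis using \<open>e > 0\<close> by (auto dest: power2_less_imp_less)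
    qed
    then show "\<exists>M. \<forall>m\<ge>M. \<forall>n\<ge>M. dist (s m) (s n) < e" by blast
  qed
  then obtain g where g: "s \<longlonglongrightarrow> g" by (auto simp: Cauchy_convergent_iff convergent_def)
  have "g \<in> S" using closed_sequentially[OF assms(2) _ g] s(1) by blast
  moreover have "(dist x g)\<^sup>2 \<le> d\<^sup>2"
  proof (rule LIMSEQ_le)
    show "(\<lambda>n. (dist x (s n))\<^sup>2) \<longlonglongrightarrow> (dist x g)\<^sup>2" by (intro tendsto_intros g)
    show "(\<lambda>n. d\<^sup>2 + inverse (real (Suc n))) \<longlonglongrightarrow> d\<^sup>2"
      using tendsto_add[OF tendsto_const LIMSEQ_inverse_real_of_nat] by simp
    show "\<exists>N. \<forall>n\<ge>N. (dist x (s n))\<^sup>2 \<le> d\<^sup>2 + inverse (real (Suc n))"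
      using s(2) less_imp_le by blast
  qed
  then have "dist x g \<le> d" using d0 by (rule power2_le_imp_le)
  ultimately show ?thesis using le by (meson order_trans)
qed

lemma orthogonal_decomposition_exists:
  fixes S :: "'h::{real_inner, complete_space} set"
  assumes "subspace S" "closed S"
  shows "\<exists>g\<in>S. \<forall>h\<in>S. inner (x - g) h = 0"
proof -
  have conv: "convex S" by (rule subspace_imp_convex[OF assms(1)])
  moreover have "S \<noteq> {}" using subspace_0[OF assms(1)] by auto
  ultimately obtain g where g: "g \<in> S" "\<forall>h\<in>S. dist x g \<le> dist x h"
    using nearest_point_exists assms(2) by blast
  have "inner (x - g) h \<le> 0" if "h \<in> S" for h
    using any_closest_point_dot[OF conv assms(2) g(1) subspace_add[OF assms(1) g(1) that] g(2)]
    by simp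
  then have "inner (x - g) h = 0" if "h \<in> S" for h
    using that subspace_neg[OF assms(1) that] by (metis inner_minus_right neg_le_0_iff_le order_antisym)
  then show ?thesis using g(1) by blast
qed

text \<open>
  The representing vector is the multiple of a vector orthogonal to the kernel that gives the right
  value on that vector.
\<close>

lemma Riesz_representation_exists:
  fixes \<phi> :: "'h::{real_inner, complete_space} \<Rightarrow> real"
  assumes "bounded_linear \<phi>"
  shows "\<exists>z. \<forall>x. \<phi> x = inner x z"
proof (cases "\<forall>x. \<phi> x = 0")
  case True
  then show ?thesis by (intro exI[of _ 0]) simp
next
  case False
  interpret bounded_linear \<phi> by (rule assms)
  define N where "N = {x. \<phi> x = 0}"
  have "subspace N" by (auto simp: subspace_def N_def add scaleR zero)
  moreover have "closed N"
    unfolding N_def by (intro closed_Collect_eq continuous_on continuous_on_const continuous_on_id)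
  moreover obtain u where u: "\<phi> u \<noteq> 0" using False by blast
  ultimately obtain g where g: "g \<in> N" "\<And>h. h \<in> N \<Longrightarrow> inner (u - g) h = 0"
    using orthogonal_decomposition_exists by metis
  define z where "z = u - g"
  have z: "\<phi> z \<noteq> 0" using u g(1) by (simp add: z_def N_def diff)
  then have nz: "inner z z \<noteq> 0" using zero by auto
  have "\<phi> x = inner x ((\<phi> z / inner z z) *\<^sub>R z)" for x
  proof -
    have "x - (\<phi> x / \<phi> z) *\<^sub>R z \<in> N" using z by (simp add: N_def diff scaleR)
    then have "inner z (x - (\<phi> x / \<phi> z) *\<^sub>R z) = 0" using g(2) z_def by blast
    then have "inner x z = \<phi> x / \<phi> z * inner z z" by (simp add: inner_diff_right inner_commute)
    then show ?thesis using z nz by simp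
  qed
  then show ?thesis by blast
qed

text \<open>
  Uniform boundedness of the functionals given by \<open>g f / N f\<close>, stated without the division so that
  \<open>N\<close> may vanish; where it does, the bound forces \<open>g f = 0\<close>. The sets of
  those \<open>x\<close> for which the constant \<open>n\<close> works are closed and cover the space, so one of them contains
  a ball; the values at two points of that ball, the centre and one displaced in the direction of
  \<open>g f\<close>, bound \<open>\<parallel>g f\<parallel>\<close>.
\<close>

lemma weakly_dominated_imp_dominated:
  fixes g :: "'a \<Rightarrow> 'h::{real_inner, complete_space}" and N :: "'a \<Rightarrow> real"
  assumes N0: "\<And>f. 0 \<le> N f"
    and weak: "\<And>x. \<exists>C. \<forall>f. \<bar>inner (g f) x\<bar> \<le> C * N f"
  shows "\<exists>C>0. \<forall>f. norm (g f) \<le> C * N f"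
proof -
  define F where "F n = {x. \<forall>f. \<bar>inner (g f) x\<bar> \<le> real n * N f}" for n :: nat
  have closed: "closed (F n)" for n
    unfolding F_def
    by (rule closed_Collect_all, rule closed_Collect_le) (intro continuous_intros)+
  have cover: "\<Union> (range F) = UNIV"
  proof -
    have "\<exists>n. x \<in> F n" for x
    proof -
      obtain C where C: "\<And>f. \<bar>inner (g f) x\<bar> \<le> C * N f" using weak by blast
      obtain n where "C \<le> real n" using real_arch_simple by blast
      then have "\<bar>inner (g f) x\<bar> \<le> real n * N f" for f
        using C[of f] mult_right_mono[OF _ N0, of C "real n" f] by linarith
      then show ?thesis by (auto simp: F_def)
    qed
    then show ?thesis by blast
  qed
  have "\<exists>n. interior (F n) \<noteq> {}"
  proof (rule ccontr)
    assume "\<not> ?thesis"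
    then have "euclidean interior_of \<Union> (range F) = {}"
      using closed by (intro Baire_category_alt disjI1 completely_metrizable_space_euclidean) auto
    then show False using cover by simp
  qed
  then obtain n p where "p \<in> interior (F n)" by blast
  then obtain r where r: "r > 0" "cball p r \<subseteq> F n" by (auto simp: mem_interior_cball)
  have "norm (g f) \<le> 2 * (real n + 1) / r * N f" for f
  proof (cases "g f = 0")
    case True
    then show ?thesis using N0 r(1) by simp
  next
    case False
    define q where "q = p + (r / norm (g f)) *\<^sub>R g f"
    have "p \<in> cball p r" "q \<in> cball p r" using r(1) False by (auto simp: q_def dist_norm)
    then have b: "\<bar>inner (g f) p\<bar> \<le> real n * N f" "\<bar>inner (g f) q\<bar> \<le> real n * N f"
      using r(2) unfolding F_def by blast+
    have "inner (g f) q = inner (g f) p + r * norm (g f)"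
      using False by (simp add: q_def inner_add_right power2_norm_eq_inner[symmetric] power2_eq_square)
    then have "r * norm (g f) \<le> 2 * (real n + 1) * N f"
      using b N0[of f] by (simp add: algebra_simps)
    then show ?thesis using r(1) by (simp add: field_simps)
  qed
  moreover have "2 * (real n + 1) / r > 0" using r(1) by simp
  ultimately show ?thesis by blast
qed

section \<open>Square-summable families\<close>

lemma L2_set_le_sqrt_infsum:
  assumes "(\<lambda>i. (x i)\<^sup>2) summable_on I" "finite F" "F \<subseteq> I"
  shows "L2_set x F \<le> sqrt (\<Sum>\<^sub>\<infinity>i\<in>I. (x i)\<^sup>2)"
  unfolding L2_set_def
  by (intro real_sqrt_le_mono finite_sum_le_infsum assms) simp

lemma Minkowski_infsum:
  fixes x y :: "'i \<Rightarrow> 'h::real_normed_vector"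
  assumes x: "(\<lambda>i. (norm (x i))\<^sup>2) summable_on I"
    and y: "(\<lambda>i. (norm (y i))\<^sup>2) summable_on I"
    and d: "(\<lambda>i. (norm (x i - y i))\<^sup>2) summable_on I"
  shows "sqrt (\<Sum>\<^sub>\<infinity>i\<in>I. (norm (x i))\<^sup>2)
    \<le> sqrt (\<Sum>\<^sub>\<infinity>i\<in>I. (norm (y i))\<^sup>2) + sqrt (\<Sum>\<^sub>\<infinity>i\<in>I. (norm (x i - y i))\<^sup>2)" (is "_ \<le> ?R")
proof (rule real_le_lsqrt)
  show R0: "0 \<le> ?R" by (intro add_nonneg_nonneg real_sqrt_ge_zero infsum_nonneg) auto
  show "(\<Sum>\<^sub>\<infinity>i\<in>I. (norm (x i))\<^sup>2) \<le> ?R\<^sup>2"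
  proof (rule infsum_le_finite_sums[OF x])
    fix F assume F: "finite F" "F \<subseteq> I"
    have "L2_set (\<lambda>i. norm (x i)) F \<le> L2_set (\<lambda>i. norm (y i) + norm (x i - y i)) F"
      by (intro L2_set_mono) (auto simp: norm_triangle_sub)
    also have "\<dots> \<le> L2_set (\<lambda>i. norm (y i)) F + L2_set (\<lambda>i. norm (x i - y i)) F"
      by (rule L2_set_triangle_ineq)
    also have "\<dots> \<le> ?R"
      by (intro add_mono L2_set_le_sqrt_infsum y d F)
    finally show "(\<Sum>i\<in>F. (norm (x i))\<^sup>2) \<le> ?R\<^sup>2"
      unfolding L2_set_def by (rule sqrt_le_D)
  qed
qed

text \<open>
  This is the estimate \<open>\<bar>\<langle>f, T y\<rangle>\<bar> \<le> \<parallel>T\<^sup>* f\<parallel> \<parallel>y\<parallel>\<close> for a synthesis operator \<open>T\<close>: when \<open>y_i \<in> V_i\<close>,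
  the vector \<open>f\<close> may be replaced by its projection \<open>p_i\<close> onto \<open>V_i\<close> in the \<open>i\<close>-th summand.
\<close>

lemma inner_synthesis_le:
  fixes f :: "'h::real_inner"
  assumes p: "(\<lambda>i. (v i)\<^sup>2 * (norm (p i))\<^sup>2) summable_on I"
    and y: "(\<lambda>i. (norm (y i))\<^sup>2) summable_on I"
    and proj: "\<And>i. i \<in> I \<Longrightarrow> inner f (y i) = inner (p i) (y i)"
  shows "\<bar>inner f (synthesis I v y)\<bar>
    \<le> sqrt (\<Sum>\<^sub>\<infinity>i\<in>I. (norm (y i))\<^sup>2) * sqrt (\<Sum>\<^sub>\<infinity>i\<in>I. (v i)\<^sup>2 * (norm (p i))\<^sup>2)" (is "_ \<le> ?Y * ?P")
proof (cases "(\<lambda>i. v i *\<^sub>R y i) summable_on I")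
  case False
  \<comment> \<open>The sum takes the default value \<open>0\<close>, so the estimate is trivial.\<close>
  then show ?thesis by (simp add: synthesis_def infsum_not_exists infsum_nonneg)
next
  case True
  have p': "(\<lambda>i. (\<bar>v i\<bar> * norm (p i))\<^sup>2) = (\<lambda>i. (v i)\<^sup>2 * (norm (p i))\<^sup>2)"
    by (simp add: power_mult_distrib)
  have fin: "\<bar>\<Sum>i\<in>F. inner f (v i *\<^sub>R y i)\<bar> \<le> ?Y * ?P" if F: "finite F" "F \<subseteq> I" for F
  proof -
    have "\<bar>\<Sum>i\<in>F. inner f (v i *\<^sub>R y i)\<bar> \<le> (\<Sum>i\<in>F. \<bar>\<bar>v i\<bar> * norm (p i)\<bar> * \<bar>norm (y i)\<bar>)"
    proof (rule order_trans[OF sum_abs sum_mono])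
      fix i assume "i \<in> F"
      then have "\<bar>inner f (v i *\<^sub>R y i)\<bar> = \<bar>v i\<bar> * \<bar>inner (p i) (y i)\<bar>"
        using F(2) proj[of i] by (auto simp: abs_mult)
      also have "\<dots> \<le> \<bar>v i\<bar> * (norm (p i) * norm (y i))"
        by (intro mult_left_mono Cauchy_Schwarz_ineq2) simp
      finally show "\<bar>inner f (v i *\<^sub>R y i)\<bar> \<le> \<bar>\<bar>v i\<bar> * norm (p i)\<bar> * \<bar>norm (y i)\<bar>"
        by (simp add: abs_mult mult.assoc)
    qed
    also have "\<dots> \<le> L2_set (\<lambda>i. \<bar>v i\<bar> * norm (p i)) F * L2_set (\<lambda>i. norm (y i)) F"
      by (rule L2_set_mult_ineq)
    also have "\<dots> \<le> ?P * ?Y"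
      using L2_set_le_sqrt_infsum[of "\<lambda>i. \<bar>v i\<bar> * norm (p i)" I F] L2_set_le_sqrt_infsum[OF y F] p F
      unfolding p' by (intro mult_mono) (auto intro: infsum_nonneg)
    finally show ?thesis by (simp add: mult.commute)
  qed
  have "((\<lambda>i. v i *\<^sub>R y i) has_sum synthesis I v y) I"
    unfolding synthesis_def using True by (rule has_sum_infsum)
  from has_sum_bounded_linear[OF bounded_linear_inner_right this]
  have hs: "((\<lambda>i. inner f (v i *\<^sub>R y i)) has_sum inner f (synthesis I v y)) I" by (simp add: o_def)
  have "inner f (synthesis I v y) \<le> ?Y * ?P"
    by (rule has_sum_le_finite_sums[OF hs]) (use fin in fastforce)
  moreover have "- inner f (synthesis I v y) \<le> ?Y * ?P"
  proof (rule has_sum_le_finite_sums)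
    show "((\<lambda>i. - inner f (v i *\<^sub>R y i)) has_sum - inner f (synthesis I v y)) I"
      using hs by (simp only: has_sum_uminus minus_minus)
    show "(\<Sum>i\<in>F. - inner f (v i *\<^sub>R y i)) \<le> ?Y * ?P" if "finite F" "F \<subseteq> I" for F
      using fin[OF that] by (simp add: sum_negf del: inner_scaleR_right)
  qed
  ultimately show ?thesis by linarith
qed

section \<open>Projections and adjoints over the scalar field\<close>

context hilbert_over
begin

text \<open>
  For \<open>u = conjg d\<close> the product \<open>u * d\<close> is the real number \<open>(norm d)\<^sup>2\<close>, so vanishing of its real
  part forces \<open>d = 0\<close>.
\<close>

lemma scalar_eq_0_if_real_parts_eq_0:
  fixes d :: 'k
  assumes "\<And>u. u * d + conjg (u * d) = 0"
  shows "d = 0"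
proof -
  have "conjg d * d = of_real ((norm d)\<^sup>2)" using mult_conjg[of d] by (simp add: mult.commute)
  then have "of_real ((norm d)\<^sup>2) + of_real ((norm d)\<^sup>2) = (0::'k)"
    using assms[of "conjg d"] by (simp only: conjg_of_real)
  then have "(norm d)\<^sup>2 + (norm d)\<^sup>2 = 0" by (simp only: of_real_add[symmetric] of_real_eq_0_iff)
  then show ?thesis by simp
qed

lemma conjg_0: "conjg (0::'k) = 0"
  using conjg_of_real[of 0, where 'a='k] by simp

lemma conjg_diff: "conjg (x - y :: 'k) = conjg x - conjg y"
  using conjg_add[of "x - y" y] by simp

lemma inner_eq_if_ip_eq: "ip x y = ip x' y' \<Longrightarrow> inner x y = inner x' y'"
  using ip_real_part[of x y] ip_real_part[of x' y'] by (metis mult_left_cancel of_real_eq_iff zero_neq_numeral)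

lemma ip_eq_0_iff: "ip x y = 0 \<longleftrightarrow> ip y x = 0"
  using ip_conjg[of x y] ip_conjg[of y x] conjg_0 by auto

lemma ip_0_left: "ip 0 y = 0"
  using ip_add[of 0 0 y] by simp

lemma ip_diff_left: "ip (x - y) z = ip x z - ip y z"
  using ip_add[of "x - y" y z] by simp

lemma ip_diff_right: "ip x (y - z) = ip x y - ip x z"
  by (metis ip_conjg ip_diff_left conjg_diff)

lemma inner_eq_0_if_ip_eq_0: "ip x y = 0 \<Longrightarrow> inner x y = 0"
  using inner_eq_if_ip_eq[of x y 0 y] by (simp add: ip_0_left)

lemma ip_self_eq_0: "ip x x = 0 \<Longrightarrow> x = 0"
  using inner_eq_0_if_ip_eq_0[of x x] by simp

lemma subspace_over_reals:
  assumes "module.subspace scl S"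
  shows "real_vector.subspace S"
proof (rule real_vector.subspaceI)
  show "0 \<in> S" by (rule subspace_0[OF assms])
  show "x + y \<in> S" if "x \<in> S" "y \<in> S" for x y using that by (rule subspace_add[OF assms])
  show "r *\<^sub>R x \<in> S" if "x \<in> S" for r x
    using subspace_scale[OF assms that, of "of_real r"] unfolding scl_of_real .
qed

lemma orth_proj_orthogonal:
  assumes "closed_subspace scl S" "h \<in> S"
  shows "ip (f - orth_proj ip S f) h = 0"
proof -
  have S: "module.subspace scl S" and closed: "closed S"
    using assms(1) by (auto simp: closed_subspace_def)
  obtain g where g: "g \<in> S" "\<And>h. h \<in> S \<Longrightarrow> inner (f - g) h = 0"
    using orthogonal_decomposition_exists[OF subspace_over_reals[OF S] closed] by blast
  have orth: "ip (f - g) h = 0" if "h \<in> S" for h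
  proof -
    have "u * ip h (f - g) + conjg (u * ip h (f - g)) = 0" for u
      using ip_real_part[of "scl u h" "f - g"] g(2)[OF subspace_scale[OF S that, of u]]
      by (simp add: ip_scl inner_commute)
    then show ?thesis using scalar_eq_0_if_real_parts_eq_0 ip_eq_0_iff by blast
  qed
  have unique: "g' = g" if g': "g' \<in> S" "\<forall>h\<in>S. ip (f - g') h = 0" for g'
  proof -
    have "g - g' \<in> S" using subspace_diff[OF S g(1) g'(1)] .
    then have "ip (f - g') (g - g') - ip (f - g) (g - g') = 0" using orth g'(2) by simp
    then have "ip (g - g') (g - g') = 0" by (simp add: ip_diff_left)
    from ip_self_eq_0[OF this] show ?thesis by simp
  qed
  have "orth_proj ip S f \<in> S \<and> (\<forall>h\<in>S. ip (f - orth_proj ip S f) h = 0)"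
    unfolding orth_proj_def
    by (rule theI[of "\<lambda>g. g \<in> S \<and> (\<forall>h\<in>S. ip (f - g) h = 0)" g]) (use g(1) orth unique in blast)+
  then show ?thesis using assms(2) by blast
qed

lemma inner_orth_proj:
  assumes "closed_subspace scl S" "h \<in> S"
  shows "inner f h = inner (orth_proj ip S f) h"
  using inner_eq_0_if_ip_eq_0[OF orth_proj_orthogonal[OF assms]] by (simp add: inner_diff_left)

lemma ip_adj:
  assumes "bounded_op scl K"
  shows "ip (K x) y = ip x (adj ip K y)"
proof -
  have K: "bounded_linear K" and lin: "\<And>u x. K (scl u x) = scl u (K x)"
    using assms by (auto simp: bounded_op_def Vector_Spaces.linear_iff)
  have "\<exists>z. \<forall>x. inner (K x) y = inner x z" for y
    by (intro Riesz_representation_exists bounded_linear_compose[OF bounded_linear_inner_left K])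
  then obtain L where L: "\<And>x y. inner (K x) y = inner x (L y)" by metis
  have ipL: "ip (K x) y = ip x (L y)" for x y
  proof -
    let ?d = "ip (K x) y - ip x (L y)"
    have "u * ?d + conjg (u * ?d) = 0" for u
    proof -
      have "u * ?d = ip (K (scl u x)) y - ip (scl u x) (L y)"
        by (simp add: lin ip_scl right_diff_distrib)
      then have "u * ?d + conjg (u * ?d)
        = (ip (K (scl u x)) y + conjg (ip (K (scl u x)) y)) - (ip (scl u x) (L y) + conjg (ip (scl u x) (L y)))"
        by (simp add: conjg_diff)
      then show ?thesis unfolding ip_real_part by (simp add: L)
    qed
    then show ?thesis using scalar_eq_0_if_real_parts_eq_0[of ?d] by auto
  qed
  have unique: "L' = L" if L': "\<forall>x y. ip (K x) y = ip x (L' y)" for L'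
  proof
    fix y
    have "ip (L' y - L y) (L' y - L y) = 0" using L' ipL by (simp add: ip_diff_right)
    from ip_self_eq_0[OF this] show "L' y = L y" by simp
  qed
  have "\<forall>x y. ip (K x) y = ip x (adj ip K y)"
    unfolding adj_def
    by (rule theI[of "\<lambda>L. \<forall>x y. ip (K x) y = ip x (L y)" L]) (use ipL unique in blast)+
  then show ?thesis by blast
qed

lemma inner_adj: "bounded_op scl K \<Longrightarrow> inner (K x) y = inner x (adj ip K y)"
  by (rule inner_eq_if_ip_eq[OF ip_adj])

lemma norm_adj_le:
  assumes "bounded_op scl K"
  shows "norm (adj ip K f) \<le> onorm K * norm f"
proof (cases "adj ip K f = 0")
  case True
  then show ?thesis using assms by (simp add: bounded_op_def onorm_pos_le)
next
  case False
  let ?g = "adj ip K f"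
  have "norm ?g * norm ?g = inner (K ?g) f"
    by (simp add: inner_adj[OF assms] power2_norm_eq_inner[symmetric] power2_eq_square)
  also have "\<dots> \<le> norm (K ?g) * norm f" by (rule norm_cauchy_schwarz)
  also have "\<dots> \<le> onorm K * norm ?g * norm f"
    using assms by (intro mult_right_mono onorm) (auto simp: bounded_op_def)
  finally show ?thesis using False by (simp add: mult.assoc mult.left_commute)
qed

text \<open>
  This is the implication from range inclusion to operator domination in Douglas' theorem, with
  the square of \<open>\<parallel>T\<^sup>* f\<parallel>\<close> written as the series of the weighted projections.
\<close>

lemma adj_dominated_if_range_subset_synthesis:
  assumes K: "bounded_op scl K" and V: "weighted_collection scl I V v"
    and summable: "\<And>f. fusion_term ip V v f summable_on I"
    and range: "range K \<subseteq> synthesis I v ` l2_direct_sum I V"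
  shows "\<exists>C>0. \<forall>f. norm (adj ip K f) \<le> C * sqrt (\<Sum>\<^sub>\<infinity>i\<in>I. fusion_term ip V v f i)"
proof (rule weakly_dominated_imp_dominated)
  show "0 \<le> sqrt (\<Sum>\<^sub>\<infinity>i\<in>I. fusion_term ip V v f i)" for f
    by (auto intro: infsum_nonneg simp: fusion_term_def)
  fix x
  obtain y where y: "y \<in> l2_direct_sum I V" "K x = synthesis I v y" using range by blast
  have "\<bar>inner (adj ip K f) x\<bar>
      \<le> sqrt (\<Sum>\<^sub>\<infinity>i\<in>I. (norm (y i))\<^sup>2) * sqrt (\<Sum>\<^sub>\<infinity>i\<in>I. fusion_term ip V v f i)" for f
  proof -
    have "inner (adj ip K f) x = inner f (synthesis I v y)"
      using inner_adj[OF K, of x f] y(2) by (simp add: inner_commute)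
    moreover have "inner f (y i) = inner (orth_proj ip (V i) f) (y i)" if "i \<in> I" for i
      using V y(1) that by (intro inner_orth_proj) (auto simp: weighted_collection_def l2_direct_sum_def)
    ultimately show ?thesis
      using inner_synthesis_le[of v "\<lambda>i. orth_proj ip (V i) f" I y f] summable[of f] y(1)
      unfolding fusion_term_def[abs_def] by (simp add: l2_direct_sum_def)
  qed
  then show "\<exists>C. \<forall>f. \<bar>inner (adj ip K f) x\<bar> \<le> C * sqrt (\<Sum>\<^sub>\<infinity>i\<in>I. fusion_term ip V v f i)" by blast
qed

end

section \<open>Stability under perturbation\<close>

lemma perturbation_two_sided:
  fixes ip :: "'h::real_inner \<Rightarrow> 'h \<Rightarrow> 'k::rc_field"
  assumes D: "(\<lambda>i. (norm (w i *\<^sub>R orth_proj ip (W i) f - v i *\<^sub>R orth_proj ip (V i) f))\<^sup>2) summable_on I"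
    and W: "fusion_term ip W w f summable_on I"
    and V: "fusion_term ip V v f summable_on I"
    and pert: "sqrt (\<Sum>\<^sub>\<infinity>i\<in>I. (norm (w i *\<^sub>R orth_proj ip (W i) f - v i *\<^sub>R orth_proj ip (V i) f))\<^sup>2)
           \<le> a * sqrt (\<Sum>\<^sub>\<infinity>i\<in>I. fusion_term ip W w f i)
             + b * sqrt (\<Sum>\<^sub>\<infinity>i\<in>I. fusion_term ip V v f i) + e"
  shows "(1 - b) * sqrt (\<Sum>\<^sub>\<infinity>i\<in>I. fusion_term ip V v f i)
      \<le> (1 + a) * sqrt (\<Sum>\<^sub>\<infinity>i\<in>I. fusion_term ip W w f i) + e"
    and "(1 - a) * sqrt (\<Sum>\<^sub>\<infinity>i\<in>I. fusion_term ip W w f i) - e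
      \<le> (1 + b) * sqrt (\<Sum>\<^sub>\<infinity>i\<in>I. fusion_term ip V v f i)"
proof -
  let ?x = "\<lambda>i. w i *\<^sub>R orth_proj ip (W i) f" and ?y = "\<lambda>i. v i *\<^sub>R orth_proj ip (V i) f"
  have eq: "fusion_term ip U u f = (\<lambda>i. (norm (u i *\<^sub>R orth_proj ip (U i) f))\<^sup>2)"
    for U :: "'i \<Rightarrow> 'h set" and u
    by (simp add: fun_eq_iff fusion_term_def power_mult_distrib)
  have sym: "norm (?y i - ?x i) = norm (?x i - ?y i)" for i by (rule norm_minus_commute)
  note W' = W[unfolded eq] and V' = V[unfolded eq]
  have "sqrt (\<Sum>\<^sub>\<infinity>i\<in>I. (norm (?x i))\<^sup>2)
      \<le> sqrt (\<Sum>\<^sub>\<infinity>i\<in>I. (norm (?y i))\<^sup>2) + sqrt (\<Sum>\<^sub>\<infinity>i\<in>I. (norm (?x i - ?y i))\<^sup>2)"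
    by (rule Minkowski_infsum[OF W' V' D])
  moreover have "sqrt (\<Sum>\<^sub>\<infinity>i\<in>I. (norm (?y i))\<^sup>2)
      \<le> sqrt (\<Sum>\<^sub>\<infinity>i\<in>I. (norm (?x i))\<^sup>2) + sqrt (\<Sum>\<^sub>\<infinity>i\<in>I. (norm (?x i - ?y i))\<^sup>2)"
    using Minkowski_infsum[OF V' W'] D unfolding sym by blast
  ultimately show "(1 - b) * sqrt (\<Sum>\<^sub>\<infinity>i\<in>I. fusion_term ip V v f i)
      \<le> (1 + a) * sqrt (\<Sum>\<^sub>\<infinity>i\<in>I. fusion_term ip W w f i) + e"
    "(1 - a) * sqrt (\<Sum>\<^sub>\<infinity>i\<in>I. fusion_term ip W w f i) - e
      \<le> (1 + b) * sqrt (\<Sum>\<^sub>\<infinity>i\<in>I. fusion_term ip V v f i)"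
    using pert unfolding eq by (simp_all add: algebra_simps)
qed

lemma sqrt_le_mult_iff:
  fixes s q n :: real
  assumes "0 \<le> q" "0 \<le> n"
  shows "sqrt s \<le> q * n \<longleftrightarrow> s \<le> q\<^sup>2 * n\<^sup>2"
  using assms by (metis mult_nonneg_nonneg power_mult_distrib real_sqrt_le_iff real_sqrt_unique)

lemma mult_le_sqrt_iff:
  fixes s q n :: real
  assumes "0 \<le> q" "0 \<le> n"
  shows "q * n \<le> sqrt s \<longleftrightarrow> q\<^sup>2 * n\<^sup>2 \<le> s"
  using assms by (metis mult_nonneg_nonneg power_mult_distrib real_sqrt_le_iff real_sqrt_unique)

theorem theorem4p4:
  fixes scl :: "'k::rc_field \<Rightarrow> 'h::{real_inner, complete_space} \<Rightarrow> 'h"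
    and ip :: "'h \<Rightarrow> 'h \<Rightarrow> 'k"
    and I :: "'i set"
    and W V :: "'i \<Rightarrow> 'h set" and w v :: "'i \<Rightarrow> real"
    and a b c :: real and \<Lambda> :: "'h \<Rightarrow> real"
  assumes "hilbert_over scl ip"
    and "separable_space (euclidean :: 'h topology)"
    and "countable I"
    and "a \<ge> 0" "b \<ge> 0" "c \<ge> 0"
    and "weighted_collection scl I W w" "weighted_collection scl I V v"
    and "\<And>f. \<Lambda> f \<ge> 0"
    and "\<And>f. (\<lambda>i. (norm (w i *\<^sub>R orth_proj ip (W i) f - v i *\<^sub>R orth_proj ip (V i) f))\<^sup>2) summable_on I"
    and "\<And>f. fusion_term ip W w f summable_on I"
    and "\<And>f. fusion_term ip V v f summable_on I"
    and "\<And>f. sqrt (\<Sum>\<^sub>\<infinity>i\<in>I. (norm (w i *\<^sub>R orth_proj ip (W i) f - v i *\<^sub>R orth_proj ip (V i) f))\<^sup>2)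
           \<le> a * sqrt (\<Sum>\<^sub>\<infinity>i\<in>I. fusion_term ip W w f i)
             + b * sqrt (\<Sum>\<^sub>\<infinity>i\<in>I. fusion_term ip V v f i) + c * \<Lambda> f"
  shows "((\<exists>B. fusion_bessel ip I W w B) \<and> b < 1 \<and> c = 0 \<longrightarrow>
            (\<forall>K. bounded_op scl K \<and> range K \<subseteq> synthesis I v ` l2_direct_sum I V \<longrightarrow>
                 (\<exists>A B. K_fusion_frame ip K I V v A B)))
       \<and> (\<forall>K A B. bounded_op scl K \<and> K_fusion_frame ip K I W w A B \<and>
              (\<forall>f. \<Lambda> f = norm (adj ip K f)) \<and>
              a < 1 \<and> b < 1 \<and> 0 \<le> c / (1 - a) \<and> c / (1 - a) < sqrt A \<longrightarrow>
              K_fusion_frame ip K I V v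
                (((sqrt A * (1 - a) - c) / (1 + b))\<^sup>2)
                ((((1 + a) * sqrt B + c * onorm K) / (1 - b))\<^sup>2))
       \<and> (\<forall>A B. fusion_frame ip I W w A B \<and> (\<forall>f. \<Lambda> f = norm f) \<and>
              a * sqrt B + c < sqrt A \<and> b < 1 \<longrightarrow>
              fusion_frame ip I V v
                (((sqrt A - c - a * sqrt B) / (1 + b))\<^sup>2)
                ((((1 + a) * sqrt B + c) / (1 - b))\<^sup>2))"
proof -
  interpret hilbert_over scl ip by fact
  note a = \<open>a \<ge> 0\<close> and b = \<open>b \<ge> 0\<close> and c = \<open>c \<ge> 0\<close>
  define sW where "sW f = (\<Sum>\<^sub>\<infinity>i\<in>I. fusion_term ip W w f i)" for f
  define sV where "sV f = (\<Sum>\<^sub>\<infinity>i\<in>I. fusion_term ip V v f i)" for f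
  have upper: "(1 - b) * sqrt (sV f) \<le> (1 + a) * sqrt (sW f) + c * \<Lambda> f"
    and lower: "(1 - a) * sqrt (sW f) - c * \<Lambda> f \<le> (1 + b) * sqrt (sV f)" for f
    unfolding sW_def sV_def
    using perturbation_two_sided[OF assms(10-13), of f] by blast+
  \<comment> \<open>Both upper bounds below, and the Bessel bound, are instances of this one,
      where \<open>k\<close> bounds \<open>\<Lambda>\<close> by the norm.\<close>
  have bessel: "sV f \<le> (((1 + a) * sqrt B + c * k) / (1 - b))\<^sup>2 * (norm f)\<^sup>2"
    if "b < 1" "B > 0" "k \<ge> 0" "sW f \<le> B * (norm f)\<^sup>2" "c * \<Lambda> f \<le> c * (k * norm f)" for B k f
  proof (subst sqrt_le_mult_iff[symmetric])
    have "sqrt (sW f) \<le> sqrt B * norm f"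
      using real_sqrt_le_mono[OF that(4)] by (simp add: real_sqrt_mult)
    then have "(1 + a) * sqrt (sW f) \<le> (1 + a) * (sqrt B * norm f)"
      using a by (intro mult_left_mono) auto
    then have "(1 - b) * sqrt (sV f) \<le> ((1 + a) * sqrt B + c * k) * norm f"
      using upper[of f] that(5) by (simp add: algebra_simps)
    then show "sqrt (sV f) \<le> ((1 + a) * sqrt B + c * k) / (1 - b) * norm f"
      using that(1) by (simp add: field_simps)
    show "0 \<le> ((1 + a) * sqrt B + c * k) / (1 - b)" using that a c by simp
  qed simp
  have upper_pos: "((1 + a) * sqrt B + c * k) / (1 - b) > 0" if "b < 1" "B > 0" "k \<ge> 0" for B k
    using that a c by (intro divide_pos_pos add_pos_nonneg) auto
  show ?thesis
  proof (intro conjI allI impI; elim conjE exE)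
    fix K B
    assume B: "fusion_bessel ip I W w B" and b1: "b < 1" and c0: "c = 0"
      and K: "bounded_op scl K" and range: "range K \<subseteq> synthesis I v ` l2_direct_sum I V"
    obtain C where C: "C > 0" "\<And>f. norm (adj ip K f) \<le> C * sqrt (sV f)"
      using adj_dominated_if_range_subset_synthesis[OF K assms(8,12) range] unfolding sV_def by blast
    have "(1 / C)\<^sup>2 * (norm (adj ip K f))\<^sup>2 \<le> sV f" for f
      using C(1) C(2)[of f] by (subst mult_le_sqrt_iff[symmetric]) (auto simp: field_simps)
    moreover have "sV f \<le> (((1 + a) * sqrt B + c * 0) / (1 - b))\<^sup>2 * (norm f)\<^sup>2" for f
      using B b1 c0 by (intro bessel) (auto simp: fusion_bessel_def sW_def)
    ultimately have "K_fusion_frame ip K I V v ((1 / C)\<^sup>2) ((((1 + a) * sqrt B + c * 0) / (1 - b))\<^sup>2)"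
      unfolding K_fusion_frame_def sV_def
      using C(1) upper_pos[OF b1, of B 0] B assms(12) by (auto simp: fusion_bessel_def)
    then show "\<exists>A B. K_fusion_frame ip K I V v A B" by blast
  next
    fix K A B
    assume K: "bounded_op scl K" and fr: "K_fusion_frame ip K I W w A B"
      and \<Lambda>: "\<forall>f. \<Lambda> f = norm (adj ip K f)"
      and a1: "a < 1" and b1: "b < 1" and less: "c / (1 - a) < sqrt A"
    have AB: "A > 0" "B > 0" using fr by (auto simp: K_fusion_frame_def)
    have k0: "onorm K \<ge> 0" using K by (simp add: bounded_op_def onorm_pos_le)
    have pos: "(sqrt A * (1 - a) - c) / (1 + b) > 0"
      using less a1 b by (auto simp: field_simps)
    have "((sqrt A * (1 - a) - c) / (1 + b))\<^sup>2 * (norm (adj ip K f))\<^sup>2 \<le> sV f" for f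
    proof (subst mult_le_sqrt_iff[symmetric])
      let ?g = "norm (adj ip K f)"
      have "A * ?g\<^sup>2 \<le> sW f" using fr by (simp add: K_fusion_frame_def sW_def)
      then have "sqrt A * ?g \<le> sqrt (sW f)"
        using real_sqrt_le_mono by (fastforce simp: real_sqrt_mult)
      then have "(1 - a) * (sqrt A * ?g) \<le> (1 - a) * sqrt (sW f)"
        using a1 by (intro mult_left_mono) auto
      then have "(sqrt A * (1 - a) - c) * ?g \<le> (1 + b) * sqrt (sV f)"
        using lower[of f] \<Lambda> by (simp add: algebra_simps)
      then show "(sqrt A * (1 - a) - c) / (1 + b) * ?g \<le> sqrt (sV f)"
        using b by (simp add: field_simps)
    qed (use pos in auto)
    moreover have "sV f \<le> (((1 + a) * sqrt B + c * onorm K) / (1 - b))\<^sup>2 * (norm f)\<^sup>2" for f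
      using fr b1 k0 c norm_adj_le[OF K] \<Lambda>
      by (intro bessel mult_left_mono) (auto simp: K_fusion_frame_def sW_def)
    ultimately show "K_fusion_frame ip K I V v
                (((sqrt A * (1 - a) - c) / (1 + b))\<^sup>2)
                ((((1 + a) * sqrt B + c * onorm K) / (1 - b))\<^sup>2)"
      unfolding K_fusion_frame_def sV_def
      using pos upper_pos[OF b1 AB(2) k0] assms(12) by auto
  next
    fix A B
    assume fr: "fusion_frame ip I W w A B" and \<Lambda>: "\<forall>f. \<Lambda> f = norm f"
      and less: "a * sqrt B + c < sqrt A" and b1: "b < 1"
    have AB: "A > 0" "B > 0" using fr by (auto simp: fusion_frame_def fusion_bessel_def)
    have pos: "(sqrt A - c - a * sqrt B) / (1 + b) > 0" using less b by auto
    have "((sqrt A - c - a * sqrt B) / (1 + b))\<^sup>2 * (norm f)\<^sup>2 \<le> sV f" for f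
    proof (subst mult_le_sqrt_iff[symmetric])
      have "A * (norm f)\<^sup>2 \<le> sW f" "sW f \<le> B * (norm f)\<^sup>2"
        using fr by (simp_all add: fusion_frame_def fusion_bessel_def sW_def)
      then have s: "sqrt A * norm f \<le> sqrt (sW f)" "sqrt (sW f) \<le> sqrt B * norm f"
        using real_sqrt_le_mono by (fastforce simp: real_sqrt_mult)+
      \<comment> \<open>The factor \<open>1 - a\<close> may be negative here, so the two occurrences of \<open>sqrt (sW f)\<close> are
          estimated separately, from below and from above.\<close>
      have "a * sqrt (sW f) \<le> a * (sqrt B * norm f)" using a s(2) by (intro mult_left_mono)
      then have "(sqrt A - c - a * sqrt B) * norm f \<le> (1 + b) * sqrt (sV f)"
        using lower[of f] s(1) \<Lambda> by (simp add: algebra_simps)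
      then show "(sqrt A - c - a * sqrt B) / (1 + b) * norm f \<le> sqrt (sV f)"
        using b by (simp add: field_simps)
    qed (use pos in auto)
    moreover have "sV f \<le> (((1 + a) * sqrt B + c * 1) / (1 - b))\<^sup>2 * (norm f)\<^sup>2" for f
      using fr b1 \<Lambda> by (intro bessel) (auto simp: fusion_frame_def fusion_bessel_def sW_def)
    ultimately show "fusion_frame ip I V v
                (((sqrt A - c - a * sqrt B) / (1 + b))\<^sup>2)
                ((((1 + a) * sqrt B + c) / (1 - b))\<^sup>2)"
      unfolding fusion_frame_def fusion_bessel_def sV_def
      using pos upper_pos[OF b1 AB(2), of 1] assms(12) by auto
  qed
qed

end
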